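(* Let $d$ be a positive integer and $K \subset \mathbb{R}^d$ be compact. Suppose that for any $2d$ points in $K$ there exists an axis-parallel box whose axis lengths (side lengths) sum to $1$ such that every point in the box sees each of the given $2d$ points. Then there exists an axis-parallel box whose axis lengths sum to $1$ such that every point in the box sees all of $K$.
   Context: For $K \subset \mathbb{R}^d$ and $x,y \in K$, $x$ sees $y$ if the closed segment $[x,y]$ is contained in $K$. *)

theory Defs
  imports "HOL-Analysis.Analysis"
begin

text \<open>Both \<open>x\<close> and \<open>y\<close> lie in \<open>K\<close> automatically, being endpoints of the segment.\<close>

definition sees :: "'a::real_vector set \<Rightarrow> 'a \<Rightarrow> 'a \<Rightarrow> bool" where
  "sees K x y \<longleftrightarrow> closed_segment x y \<subseteq> K"

text \<open>Boxes are closed and nonempty; individual side lengths may be zero. The condition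
  \<open>a $ i \<le> b $ i\<close> makes \<open>b $ i - a $ i\<close> the \<open>i\<close>-th side length of \<open>cbox a b\<close>.\<close>

definition box_of_side_sum :: "real \<Rightarrow> (real ^ 'n) set \<Rightarrow> bool" where
  "box_of_side_sum s B \<longleftrightarrow>
     (\<exists>a b. (\<forall>i. a $ i \<le> b $ i) \<and> (\<Sum>i\<in>UNIV. b $ i - a $ i) = s \<and> B = cbox a b)"

end

theory Submission
  imports Defs
begin

text \<open>A box \<open>cbox a b\<close> of side sum 1 is a point \<open>(a, b)\<close> of a hyperplane of dimension
  \<open>2d - 1\<close>, and the boxes inside a convex set form a convex subset of it. Helly's theorem in this
  hyperplane, with Helly number \<open>2d\<close>, and compactness give a box contained in the convex hulls of
  the stars of all points of \<open>K\<close>. As in Krasnoselskii's theorem, a point lying in all these hulls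
  sees all of \<open>K\<close>.\<close>

section \<open>Helly's theorem in an affine subspace\<close>

text \<open>Induction on the index set via Radon's theorem: an affinely independent subset of
  \<open>A\<close> has at most \<open>n\<close> points, so beyond \<open>n\<close> indices distinct
  points \<open>x i\<close>, each in all sets but \<open>S i\<close>, are affinely dependent.
  Intersecting with \<open>A\<close> lets its dimension decide, not that of the ambient
  space.\<close>

lemma Helly_in_affine:
  fixes S :: "'i \<Rightarrow> 'a::euclidean_space set"
  assumes "finite I" and A: "affine A" "aff_dim A < int n"
    and conv: "\<And>i. i \<in> I \<Longrightarrow> convex (S i)"
    and small: "\<And>J. J \<subseteq> I \<Longrightarrow> card J \<le> n \<Longrightarrow> A \<inter> (\<Inter>i\<in>J. S i) \<noteq> {}"
  shows "A \<inter> (\<Inter>i\<in>I. S i) \<noteq> {}"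
  using \<open>finite I\<close> conv small
proof (induction I rule: finite_psubset_induct)
  case (psubset I)
  show ?case
  proof (cases "card I \<le> n")
    case True
    then show ?thesis using psubset.prems(2) by blast
  next
    case False
    have "\<exists>x. x \<in> A \<inter> (\<Inter>j\<in>I - {i}. S j)" if "i \<in> I" for i
    proof -
      have "A \<inter> (\<Inter>j\<in>I - {i}. S j) \<noteq> {}"
      proof (rule psubset.IH)
        show "I - {i} \<subset> I" using that by blast
        show "convex (S j)" if "j \<in> I - {i}" for j
          using that by (simp add: psubset.prems(1))
        show "A \<inter> (\<Inter>j\<in>J. S j) \<noteq> {}" if "J \<subseteq> I - {i}" "card J \<le> n" for J
          by (rule psubset.prems(2)) (use that in auto)
      qed
      then show ?thesis by blast
    qed
    then obtain x where x: "\<And>i. i \<in> I \<Longrightarrow> x i \<in> A \<inter> (\<Inter>j\<in>I - {i}. S j)"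
      by metis
    show ?thesis
    proof (cases "inj_on x I")
      case False
      then obtain i j where "i \<in> I" "j \<in> I" "i \<noteq> j" "x i = x j"
        by (auto simp: inj_on_def)
      then have "x i \<in> A \<inter> (\<Inter>k\<in>I. S k)"
        using x[of i] x[of j] by auto
      then show ?thesis by blast
    next
      case True
      have sub: "x ` I \<subseteq> A" using x by blast
      have "affine_dependent (x ` I)"
      proof (rule ccontr)
        assume "\<not> affine_dependent (x ` I)"
        then have "aff_dim (x ` I) = int (card I) - 1"
          using aff_dim_affine_independent[of "x ` I"] card_image[OF True] by linarith
        moreover have "aff_dim (x ` I) \<le> aff_dim A"
          by (rule aff_dim_subset[OF sub])
        ultimately show False using A(2) \<open>\<not> card I \<le> n\<close> by linarith
      qed
      then obtain M P where MP: "M \<subseteq> x ` I" "P \<subseteq> x ` I" "M \<inter> P = {}"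
          "convex hull M \<inter> convex hull P \<noteq> {}"
        by (rule Radon)
      then obtain z where z: "z \<in> convex hull M" "z \<in> convex hull P" by blast
      have "z \<in> S i" if "i \<in> I" for i
      proof -
        \<comment> \<open>Every \<open>x j\<close> with \<open>j \<noteq> i\<close> lies in
          \<open>S i\<close>, and of the disjoint parts \<open>M\<close> and \<open>P\<close> at
          least one omits \<open>x i\<close>.\<close>
        have *: "convex hull Q \<subseteq> S i" if "Q \<subseteq> x ` I" "x i \<notin> Q" for Q
        proof (rule hull_minimal)
          show "Q \<subseteq> S i"
          proof
            fix q assume "q \<in> Q"
            with that obtain j where "j \<in> I" "q = x j" "j \<noteq> i" by blast
            then show "q \<in> S i" using x[of j] \<open>i \<in> I\<close> by auto
          qed
        qed (rule psubset.prems(1)[OF \<open>i \<in> I\<close>])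
        show ?thesis using *[of M] *[of P] MP z by blast
      qed
      moreover have "z \<in> A"
        using z(1) hull_minimal[of M A convex] MP(1) sub affine_imp_convex[OF A(1)] by blast
      ultimately show ?thesis by blast
    qed
  qed
qed

section \<open>Stars and their convex hulls\<close>

text \<open>If \<open>u \<in> [x, y]\<close> is outside \<open>K\<close>, choose \<open>w\<close> just before the first point of \<open>K\<close> on the
  way from \<open>u\<close> to \<open>y\<close>, so that the point \<open>v\<close> of \<open>[u, w]\<close> nearest to \<open>K\<close> is not \<open>u\<close>. The star of the
  point \<open>x0\<close> of \<open>K\<close> nearest to \<open>v\<close> then lies in a half-space that excludes \<open>x\<close>.\<close>

lemma sees_if_in_star_hulls:
  fixes K :: "'a::euclidean_space set"
  assumes "closed K" "y \<in> K"
    and hull: "\<And>q. q \<in> K \<Longrightarrow> x \<in> convex hull {z. sees K z q}"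
  shows "sees K x y"
proof (rule ccontr)
  assume "\<not> sees K x y"
  then obtain u where u: "u \<in> closed_segment x y" "u \<notin> K"
    by (auto simp: sees_def)
  have "closed (K \<inter> closed_segment u y)"
    by (intro closed_Int assms(1) closed_segment)
  moreover have "y \<in> K \<inter> closed_segment u y" using assms(2) by simp
  ultimately obtain x' where x': "x' \<in> K \<inter> closed_segment u y"
      "\<And>q. q \<in> K \<inter> closed_segment u y \<Longrightarrow> dist u x' \<le> dist u q"
    using distance_attains_inf[of "K \<inter> closed_segment u y" u] by blast
  define e where "e = infdist u K"
  have "e > 0"
    unfolding e_def using assms(1,2) u(2) by (intro infdist_pos_not_in_closed) auto
  have "e \<le> dist u x'"
    unfolding e_def using x'(1) by (intro infdist_le) auto
  \<comment> \<open>This \<open>s\<close> puts \<open>w\<close> at distance \<open>e / 2\<close>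
    from \<open>x'\<close>: nearer to \<open>K\<close> than \<open>u\<close> is, yet strictly before
    \<open>x'\<close>, so that \<open>[u, w]\<close> misses \<open>K\<close>.\<close>
  define s where "s = e / (2 * dist u x')"
  have d: "dist u x' > 0" using \<open>e > 0\<close> \<open>e \<le> dist u x'\<close> by linarith
  have s: "0 < s" "s \<le> 1/2" using \<open>e > 0\<close> \<open>e \<le> dist u x'\<close> d by (auto simp: s_def field_simps)
  define w where "w = (1 - s) *\<^sub>R x' + s *\<^sub>R u"
  have w_seg: "w \<in> closed_segment u x'"
    using s unfolding w_def closed_segment_commute[of u] in_segment
    by (intro exI[of _ s]) auto
  have "w - x' = s *\<^sub>R (u - x')" by (simp add: w_def algebra_simps)
  then have dw: "dist w x' = s * dist u x'"
    using s by (simp add: dist_norm)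
  have "u - w = (1 - s) *\<^sub>R (u - x')" by (simp add: w_def algebra_simps)
  then have du: "dist u w = (1 - s) * dist u x'"
    using s by (simp add: dist_norm)
  have "(1 - s) * dist u x' < 1 * dist u x'"
    using s d by (intro mult_strict_right_mono) auto
  then have wu: "dist u w < dist u x'" using du by simp
  have we: "dist w x' < e" using dw d \<open>e > 0\<close> by (simp add: s_def)
  have sub1: "closed_segment u w \<subseteq> closed_segment u y"
    using w_seg x'(1) by (meson IntD2 convex_closed_segment convex_contains_segment
        ends_in_segment(1) subset_iff)
  have disj: "q \<notin> K" if "q \<in> closed_segment u w" for q
  proof
    assume "q \<in> K"
    then have "dist u x' \<le> dist u q" using x'(2) that sub1 by blast
    moreover have "dist u q \<le> dist u w"
      using segment_bound(1)[OF that] by (simp add: dist_norm norm_minus_commute)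
    ultimately show False using wu by linarith
  qed
  obtain v x0 where v: "v \<in> closed_segment u w" and x0: "x0 \<in> K"
      and min: "dist v x0 = setdist (closed_segment u w) K"
    using setdist_compact_closed[of "closed_segment u w" K] assms(1,2) by auto
  have le: "dist v x0 \<le> dist p q" if "p \<in> closed_segment u w" "q \<in> K" for p q
    using setdist_le_dist[OF that] min by simp
  have "v \<noteq> u"
  proof
    assume "v = u"
    then have "e \<le> dist v x0" using infdist_le[OF x0, of u] by (simp add: e_def)
    moreover have "dist v x0 \<le> dist w x'" using le x'(1) by auto
    ultimately show False using we by linarith
  qed
  have "v \<noteq> x0" using disj v x0 by blast
  \<comment> \<open>For \<open>z\<close> in the star, \<open>x0\<close> is also the point of the
    segment \<open>[z, x0]\<close> nearest to \<open>v\<close>, so the angle at \<open>x0\<close> is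
    not acute.\<close>
  have star: "{z. sees K z x0} \<subseteq> {z. (v - x0) \<bullet> z \<le> (v - x0) \<bullet> x0}"
  proof clarify
    fix z assume "sees K z x0"
    then have "closed_segment z x0 \<subseteq> K" by (simp add: sees_def)
    then have "(v - x0) \<bullet> (z - x0) \<le> 0"
      using le[OF v] by (intro any_closest_point_dot[of "closed_segment z x0"]) auto
    then show "(v - x0) \<bullet> z \<le> (v - x0) \<bullet> x0" by (simp add: inner_diff_right)
  qed
  have "x \<in> {z. (v - x0) \<bullet> z \<le> (v - x0) \<bullet> x0}"
    using hull[OF x0] hull_minimal[where S=convex, OF star convex_halfspace_le] by blast
  then have 1: "(v - x0) \<bullet> (x - x0) \<le> 0" by (simp add: inner_diff_right)
  \<comment> \<open>Conversely \<open>v\<close> is the point of \<open>[u, w]\<close> nearest to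
    \<open>x0\<close>.\<close>
  have 2: "(x0 - v) \<bullet> (u - v) \<le> 0"
    using le[OF _ x0] v
    by (intro any_closest_point_dot[of "closed_segment u w"]) (auto simp: dist_commute)
  obtain a where a: "0 \<le> a" "a \<le> 1" "u = (1 - a) *\<^sub>R x + a *\<^sub>R y"
    using u(1) by (auto simp: in_segment)
  obtain b where b: "0 \<le> b" "b \<le> 1" "v = (1 - b) *\<^sub>R u + b *\<^sub>R y"
    using subsetD[OF sub1 v] by (auto simp: in_segment)
  \<comment> \<open>The points \<open>x\<close>, \<open>u\<close>, \<open>v\<close> follow one
    another on the line towards \<open>y\<close>, and \<open>v \<noteq> u\<close> gives
    \<open>k > 0\<close>. So the bound for \<open>u - v\<close> in \<open>2\<close> carries over to
    \<open>x - v\<close>, which contradicts \<open>1\<close>.\<close>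
  define k where "k = b * (1 - a)"
  have uv: "u - v = - k *\<^sub>R (y - x)"
    unfolding k_def b(3) unfolding a(3) by (simp add: algebra_simps)
  have xv: "x - v = - (a + k) *\<^sub>R (y - x)"
    using uv unfolding a(3) by (simp add: algebra_simps)
  have "k > 0"
  proof -
    have "k \<ge> 0" using a b by (simp add: k_def)
    moreover have "k \<noteq> 0" using uv \<open>v \<noteq> u\<close> by auto
    ultimately show ?thesis by linarith
  qed
  have "(x0 - v) \<bullet> (y - x) \<ge> 0"
    using 2 \<open>k > 0\<close> unfolding uv by (simp add: zero_le_mult_iff)
  then have "(x0 - v) \<bullet> (x - v) \<le> 0"
    using \<open>k > 0\<close> a(1) unfolding xv inner_scaleR_right
    by (intro mult_nonpos_nonneg) auto
  moreover have "(v - x0) \<bullet> (x - x0) = (v - x0) \<bullet> (v - x0) - (x0 - v) \<bullet> (x - v)"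
    by (simp add: algebra_simps inner_commute)
  moreover have "(v - x0) \<bullet> (v - x0) > 0" using \<open>v \<noteq> x0\<close> by simp
  ultimately show False using 1 by linarith
qed

text \<open>For each ratio \<open>t\<close>, that the point of \<open>[z, q]\<close> at
  \<open>t\<close> lies in \<open>K\<close> is a closed condition on \<open>z\<close>.\<close>

lemma compact_star:
  fixes K :: "'a::euclidean_space set"
  assumes "compact K"
  shows "compact {z. sees K z q}"
proof -
  have "{z. sees K z q} = (\<Inter>t\<in>{0..1}. (\<lambda>z. (1 - t) *\<^sub>R z + t *\<^sub>R q) -` K)"
    unfolding sees_def closed_segment_def by fastforce
  also have "closed \<dots>"
    using compact_imp_closed[OF assms]
    by (intro closed_INT ballI closed_vimage) (auto intro!: continuous_intros)
  finally have "closed {z. sees K z q}" .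
  moreover have "{z. sees K z q} \<subseteq> K" by (auto simp: sees_def)
  ultimately show ?thesis
    using assms by (metis compact_Int_closed inf.absorb_iff2)
qed

section \<open>Boxes as pairs of corners\<close>

text \<open>The point with relative coordinates \<open>t\<close> in the box \<open>p\<close>. For
  fixed \<open>t\<close> it depends linearly on the pair of corners.\<close>

definition box_point :: "real ^ 'n \<Rightarrow> (real ^ 'n) \<times> (real ^ 'n) \<Rightarrow> real ^ 'n" where
  "box_point t p = (\<chi> i. (1 - t $ i) * fst p $ i + t $ i * snd p $ i)"

text \<open>The order condition excludes pairs with an empty \<open>cbox\<close>, which would be
  contained in every \<open>C\<close>.\<close>

definition subboxes :: "(real ^ 'n) set \<Rightarrow> ((real ^ 'n) \<times> (real ^ 'n)) set" where
  "subboxes C = {p. (\<forall>i. fst p $ i \<le> snd p $ i) \<and> cbox (fst p) (snd p) \<subseteq> C}"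

lemma linear_box_point: "linear (box_point t)"
  by (rule linearI) (simp_all add: box_point_def vec_eq_iff algebra_simps)

lemma cbox_eq_box_points:
  assumes "\<And>i. a $ i \<le> b $ i"
  shows "cbox a b = (\<lambda>t. box_point t (a, b)) ` cbox 0 1"
proof (intro equalityI subsetI)
  fix z assume z: "z \<in> cbox a b"
  \<comment> \<open>In a degenerate coordinate division by zero gives 0, which is still in
    \<open>[0, 1]\<close> and correct because \<open>z $ i = a $ i\<close> there.\<close>
  define t :: "real ^ 'a" where "t = (\<chi> i. (z $ i - a $ i) / (b $ i - a $ i))"
  have "z $ i = (1 - t $ i) * a $ i + t $ i * b $ i" for i
  proof (cases "a $ i = b $ i")
    case True
    then show ?thesis using z by (simp add: mem_box_cart t_def) (metis order_antisym)
  next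
    case False
    have "t $ i * (b $ i - a $ i) = z $ i - a $ i" using False by (simp add: t_def)
    then show ?thesis by (simp add: algebra_simps)
  qed
  then have "z = box_point t (a, b)" by (simp add: box_point_def vec_eq_iff)
  moreover have "0 \<le> t $ i \<and> t $ i \<le> 1" for i
    using z assms[of i] by (auto simp: t_def mem_box_cart divide_le_eq_1)
  then have "t \<in> cbox 0 1" by (simp add: mem_box_cart)
  ultimately show "z \<in> (\<lambda>t. box_point t (a, b)) ` cbox 0 1" by blast
next
  fix z assume "z \<in> (\<lambda>t. box_point t (a, b)) ` cbox 0 1"
  then obtain t where t: "t \<in> cbox 0 1" "z = box_point t (a, b)" by blast
  show "z \<in> cbox a b"
    unfolding mem_box_cart
  proof
    fix i
    have "0 \<le> t $ i * (b $ i - a $ i)" "0 \<le> (1 - t $ i) * (b $ i - a $ i)"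
      using t(1) assms[of i] by (auto simp: mem_box_cart)
    then show "a $ i \<le> z $ i \<and> z $ i \<le> b $ i"
      by (simp add: t(2) box_point_def algebra_simps)
  qed
qed

text \<open>Turns containment of a box into preimage conditions under linear maps, so that convexity
  and closedness pass from \<open>C\<close> to \<open>subboxes C\<close>.\<close>

lemma subboxes_eq_vimages:
  "subboxes C = (\<Inter>i. {p. fst p $ i \<le> snd p $ i}) \<inter> (\<Inter>t\<in>cbox 0 1. box_point t -` C)"
proof -
  have "cbox (fst p) (snd p) \<subseteq> C \<longleftrightarrow> (\<forall>t\<in>cbox 0 1. box_point t p \<in> C)"
    if "\<forall>i. fst p $ i \<le> snd p $ i" for p
    using cbox_eq_box_points[of "fst p" "snd p"] that by auto
  then show ?thesis by (auto simp: subboxes_def)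
qed

lemma convex_subboxes:
  assumes "convex C"
  shows "convex (subboxes C)"
proof -
  have "convex {p :: (real ^ 'a) \<times> (real ^ 'a). fst p $ i \<le> snd p $ i}" for i
    by (auto simp: convex_def intro!: add_mono mult_left_mono)
  then show ?thesis
    unfolding subboxes_eq_vimages
    by (intro convex_Int convex_INT convex_linear_vimage linear_box_point assms)
qed

lemma closed_subboxes:
  assumes "closed C"
  shows "closed (subboxes C)"
  unfolding subboxes_eq_vimages
  by (intro closed_Int closed_INT ballI closed_Collect_le continuous_intros
      continuous_closed_vimage linear_continuous_at
      linear_conv_bounded_linear[THEN iffD1] linear_box_point assms)

lemma bounded_subboxes:
  assumes "bounded C"
  shows "bounded (subboxes C)"
proof (rule bounded_subset)
  show "bounded (C \<times> C)" by (intro bounded_Times assms)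
  show "subboxes C \<subseteq> C \<times> C"
    by (auto simp: subboxes_def subset_iff mem_box_cart)
qed

lemma aff_dim_side_sum:
  "affine {p :: (real ^ 'n) \<times> (real ^ 'n). (\<Sum>i\<in>UNIV. snd p $ i - fst p $ i) = 1}" (is "affine ?A")
  "aff_dim {p :: (real ^ 'n) \<times> (real ^ 'n). (\<Sum>i\<in>UNIV. snd p $ i - fst p $ i) = 1}
    < int (2 * CARD('n))"
proof -
  \<comment> \<open>The normal vector of the hyperplane: all entries -1 on the lower corner and 1 on
    the upper one.\<close>
  let ?c = "(- 1, 1) :: (real ^ 'n) \<times> (real ^ 'n)"
  have eq: "?A = {p. ?c \<bullet> p = 1}"
    by (auto simp: inner_prod_def inner_vec_def sum_subtractf sum_negf)
  show "affine ?A" unfolding eq by (rule affine_hyperplane)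
  have "?c \<noteq> 0" by (simp add: zero_prod_def)
  then have "aff_dim ?A = int (2 * CARD('n) - 1)"
    unfolding eq by (simp add: mult_2)
  also have "\<dots> < int (2 * CARD('n))"
    by simp
  finally show "aff_dim ?A < int (2 * CARD('n))" .
qed

section \<open>From \<open>2d\<close> points to all of \<open>K\<close>\<close>

theorem theorem3p5:
  fixes K :: "(real ^ 'n) set"
  assumes "compact K"
    and "\<And>p :: nat \<Rightarrow> real ^ 'n. (\<forall>i < 2 * CARD('n). p i \<in> K) \<Longrightarrow>
           \<exists>B. box_of_side_sum 1 B \<and> (\<forall>x\<in>B. \<forall>i < 2 * CARD('n). sees K x (p i))"
  shows "\<exists>B. box_of_side_sum 1 B \<and> (\<forall>x\<in>B. \<forall>y\<in>K. sees K x y)"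
proof -
  define H where "H = {p :: (real ^ 'n) \<times> (real ^ 'n). (\<Sum>i\<in>UNIV. snd p $ i - fst p $ i) = 1}"
  define C where "C q = convex hull {z. sees K z q}" for q
  have compact_C: "compact (C q)" for q
    unfolding C_def by (intro compact_convex_hull compact_star assms(1))
  have few: "H \<inter> (\<Inter>q\<in>J. subboxes (C q)) \<noteq> {}"
    if J: "J \<subseteq> K" "finite J" "card J \<le> 2 * CARD('n)" "J \<noteq> {}" for J
  proof -
    obtain q0 where "q0 \<in> J" using J(4) by blast
    obtain f where f: "bij_betw f {0..<card J} J"
      using ex_bij_betw_nat_finite[OF J(2)] by blast
    \<comment> \<open>The hypothesis takes exactly \<open>2d\<close> points; repeating
      \<open>q0\<close> fills up a smaller \<open>J\<close>.\<close>
    define p where "p i = (if i < card J then f i else q0)" for i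
    have "p i \<in> K" for i
      using f \<open>q0 \<in> J\<close> J(1) by (auto simp: p_def bij_betw_def)
    then obtain B where B: "box_of_side_sum 1 B" "\<forall>x\<in>B. \<forall>i < 2 * CARD('n). sees K x (p i)"
      using assms(2)[of p] by blast
    then obtain a b where ab: "\<forall>i. a $ i \<le> b $ i" "(\<Sum>i\<in>UNIV. b $ i - a $ i) = 1" "B = cbox a b"
      by (auto simp: box_of_side_sum_def)
    have "(a, b) \<in> subboxes (C q)" if "q \<in> J" for q
    proof -
      have "q \<in> f ` {0..<card J}"
        using bij_betw_imp_surj_on[OF f] that by blast
      then obtain i where "i < card J" "q = f i"
        by auto
      then have "cbox a b \<subseteq> {z. sees K z q}"
        using B(2)[rule_format, of _ i] J(3) ab(3) by (auto simp: p_def)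
      then show ?thesis
        using ab(1) hull_subset[of "{z. sees K z q}" convex] by (auto simp: subboxes_def C_def)
    qed
    moreover have "(a, b) \<in> H" using ab(2) by (simp add: H_def)
    ultimately show ?thesis by blast
  qed
  have finite_many: "H \<inter> (\<Inter>q\<in>J. subboxes (C q)) \<noteq> {}" if J: "J \<subseteq> K" "finite J" "J \<noteq> {}" for J
  proof (rule Helly_in_affine[OF J(2)])
    show "affine H" "aff_dim H < int (2 * CARD('n))"
      unfolding H_def by (rule aff_dim_side_sum)+
    show "convex (subboxes (C q))" for q
      unfolding C_def by (intro convex_subboxes convex_convex_hull)
    show "H \<inter> (\<Inter>q\<in>J'. subboxes (C q)) \<noteq> {}" if "J' \<subseteq> J" "card J' \<le> 2 * CARD('n)" for J'
    proof (cases "J' = {}")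
      \<comment> \<open>For the empty subfamily only \<open>H \<noteq> {}\<close> is asked, and any
        one-point family yields it.\<close>
      case True
      obtain q where "q \<in> J" using J(3) by blast
      then show ?thesis using few[of "{q}"] J(1) True by auto
    next
      case False
      then show ?thesis using few[of J'] that J finite_subset by blast
    qed
  qed
  have "closed H"
    unfolding H_def by (intro closed_Collect_eq continuous_intros)
  show ?thesis
  proof (cases "K = {}")
    case True
    \<comment> \<open>Any box will do; this one has a single side of length 1 and all others
      0.\<close>
    have "box_of_side_sum 1 (cbox 0 (axis (undefined :: 'n) 1))"
      unfolding box_of_side_sum_def by (intro exI conjI refl) (simp_all add: axis_def)
    then show ?thesis using True by blast
  next
    case False
    then obtain q0 where "q0 \<in> K" by blast
    have cl: "closed (subboxes (C q))" for q
      by (intro closed_subboxes compact_imp_closed compact_C)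
    have "compact (subboxes (C q0))"
      using cl bounded_subboxes[OF compact_imp_bounded[OF compact_C]]
      by (simp add: compact_eq_bounded_closed)
    \<comment> \<open>The hyperplane \<open>H\<close> alone need not be compact; the subboxes of one
      bounded hull \<open>C q0\<close> cut it down to a compact set, and adding \<open>q0\<close> to
      each finite \<open>J\<close> preserves the finite intersection property.\<close>
    then have "compact (H \<inter> subboxes (C q0))"
      using \<open>closed H\<close> by (intro closed_Int_compact)
    then have "(H \<inter> subboxes (C q0)) \<inter> (\<Inter>q\<in>K. subboxes (C q)) \<noteq> {}"
    proof (rule compact_imp_fip_image[OF _ cl])
      fix J assume "finite J" "J \<subseteq> K"
      then show "(H \<inter> subboxes (C q0)) \<inter> (\<Inter>q\<in>J. subboxes (C q)) \<noteq> {}"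
        using finite_many[of "insert q0 J"] \<open>q0 \<in> K\<close> by (simp add: Int_assoc)
    qed
    then obtain a b where ab: "(a, b) \<in> H" "\<And>q. q \<in> K \<Longrightarrow> (a, b) \<in> subboxes (C q)"
      by auto
    then have "box_of_side_sum 1 (cbox a b)"
      using \<open>q0 \<in> K\<close> by (auto simp: box_of_side_sum_def H_def subboxes_def)
    moreover have "sees K x y" if "x \<in> cbox a b" "y \<in> K" for x y
      using compact_imp_closed[OF assms(1)] \<open>y \<in> K\<close>
    proof (rule sees_if_in_star_hulls)
      show "x \<in> convex hull {z. sees K z q}" if "q \<in> K" for q
        using ab(2)[OF that] \<open>x \<in> cbox a b\<close> by (auto simp: subboxes_def C_def)
    qed
    ultimately show ?thesis by blast
  qed
qed

end
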